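(* Let $u,w\in W$. Then the following are equivalent: (1) $u\leq_P w$; (2) $uv\leq_P wv$ for any $v\in W_P$; (3) $uv\leq wv$ (in the Bruhat order) for some $v\in W_P$ such that $wv\in W^P$.
   Context: $W$ is the Weyl group (with length function $\ell$, Bruhat order $\le$, positive roots $R^+$) of a complex reductive group whose derived subgroup is simple. $W_P\subset W$ is a standard parabolic subgroup with positive roots $R_P^+\subset R^+$, and $W^P$ is the set of minimal length representatives of the cosets $W/W_P$. Extended $P$-Bruhat order: write $u\stackrel{P}{\to}w$ if $w=us_\alpha$ for some $\alpha\in R^+\setminus R^+_P$ with $\ell(w)>\ell(u)$ (equivalently $u(\alpha)\in R^+$). The order $\le_P$ on $W$ is the reflexive-transitive closure of these relations. *)

theory Defs
  imports "HOL-Analysis.Analysis"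
begin

definition reflection :: "'a::euclidean_space \<Rightarrow> 'a \<Rightarrow> 'a" where
  "reflection \<alpha> x = x - (2 * (x \<bullet> \<alpha>) / (\<alpha> \<bullet> \<alpha>)) *\<^sub>R \<alpha>"

(* The roots of a complex reductive group, in the real span of its character lattice equipped
   with a Weyl-invariant inner product, form a reduced crystallographic root system.  They span
   the whole space only if the group is semisimple, so spanning is not required. *)
definition root_system :: "'a::euclidean_space set \<Rightarrow> bool" where
  "root_system R \<longleftrightarrow>
     finite R \<and> 0 \<notin> R \<and>
     (\<forall>\<alpha>\<in>R. \<forall>c::real. c *\<^sub>R \<alpha> \<in> R \<longleftrightarrow> c = 1 \<or> c = -1) \<and>
     (\<forall>\<alpha>\<in>R. reflection \<alpha> ` R = R) \<and>
     (\<forall>\<alpha>\<in>R. \<forall>\<beta>\<in>R. 2 * (\<beta> \<bullet> \<alpha>) / (\<alpha> \<bullet> \<alpha>) \<in> \<int>)"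

(* Corresponds to the derived subgroup being simple. *)
definition irreducible_root_system :: "'a::euclidean_space set \<Rightarrow> bool" where
  "irreducible_root_system R \<longleftrightarrow>
     root_system R \<and> R \<noteq> {} \<and>
     \<not> (\<exists>A B. A \<noteq> {} \<and> B \<noteq> {} \<and> A \<union> B = R \<and> (\<forall>\<alpha>\<in>A. \<forall>\<beta>\<in>B. \<alpha> \<bullet> \<beta> = 0))"

(* A set of simple roots, i.e. the choice of a Borel subgroup. *)
definition simple_roots :: "'a::euclidean_space set \<Rightarrow> 'a set \<Rightarrow> bool" where
  "simple_roots R \<Delta> \<longleftrightarrow>
     \<Delta> \<subseteq> R \<and> independent \<Delta> \<and>
     (\<forall>\<beta>\<in>R. \<exists>c::'a \<Rightarrow> int. \<beta> = (\<Sum>\<alpha>\<in>\<Delta>. of_int (c \<alpha>) *\<^sub>R \<alpha>) \<and>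
        ((\<forall>\<alpha>\<in>\<Delta>. 0 \<le> c \<alpha>) \<or> (\<forall>\<alpha>\<in>\<Delta>. c \<alpha> \<le> 0)))"

(* For the set \<Delta> of simple roots this is the set of positive roots; for a subset I of \<Delta> it is
   the set of positive roots of the standard parabolic subgroup generated by the reflections
   in I (equivalently, of the standard Levi subgroup with simple roots I). *)
definition pos_roots :: "'a::euclidean_space set \<Rightarrow> 'a set \<Rightarrow> 'a set" where
  "pos_roots R I = {\<beta> \<in> R. \<exists>c::'a \<Rightarrow> nat. \<beta> = (\<Sum>\<alpha>\<in>I. of_nat (c \<alpha>) *\<^sub>R \<alpha>)}"

definition refl_word :: "'a::euclidean_space list \<Rightarrow> 'a \<Rightarrow> 'a" where
  "refl_word \<alpha>s = foldr (\<lambda>\<alpha> f. reflection \<alpha> \<circ> f) \<alpha>s id"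

(* The group generated by the reflections in S, with composition as multiplication; reflections
   are involutions, so inverses of generators are not needed.  refl_group R is the Weyl group W,
   and refl_group I, for a set I of simple roots, is a standard parabolic subgroup. *)
definition refl_group :: "'a::euclidean_space set \<Rightarrow> ('a \<Rightarrow> 'a) set" where
  "refl_group S = refl_word ` lists S"

definition weyl_length :: "'a::euclidean_space set \<Rightarrow> ('a \<Rightarrow> 'a) \<Rightarrow> nat" where
  "weyl_length \<Delta> w = (LEAST n. \<exists>\<alpha>s \<in> lists \<Delta>. length \<alpha>s = n \<and> refl_word \<alpha>s = w)"

definition refl_step ::
  "'a::euclidean_space set \<Rightarrow> 'a set \<Rightarrow> 'a set \<Rightarrow> ('a \<Rightarrow> 'a) \<Rightarrow> ('a \<Rightarrow> 'a) \<Rightarrow> bool" where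
  "refl_step R \<Delta> A u w \<longleftrightarrow>
     u \<in> refl_group R \<and>
     (\<exists>\<alpha>\<in>A. w = u \<circ> reflection \<alpha> \<and> weyl_length \<Delta> u < weyl_length \<Delta> w)"

definition bruhat_le ::
  "'a::euclidean_space set \<Rightarrow> 'a set \<Rightarrow> ('a \<Rightarrow> 'a) \<Rightarrow> ('a \<Rightarrow> 'a) \<Rightarrow> bool" where
  "bruhat_le R \<Delta> = (refl_step R \<Delta> (pos_roots R \<Delta>))\<^sup>*\<^sup>*"

definition ext_P_bruhat_le ::
  "'a::euclidean_space set \<Rightarrow> 'a set \<Rightarrow> 'a set \<Rightarrow> ('a \<Rightarrow> 'a) \<Rightarrow> ('a \<Rightarrow> 'a) \<Rightarrow> bool" where
  "ext_P_bruhat_le R \<Delta> I = (refl_step R \<Delta> (pos_roots R \<Delta> - pos_roots R I))\<^sup>*\<^sup>*"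

definition min_coset_reps :: "'a::euclidean_space set \<Rightarrow> 'a set \<Rightarrow> 'a set \<Rightarrow> ('a \<Rightarrow> 'a) set" where
  "min_coset_reps R \<Delta> I =
     {w \<in> refl_group R. \<forall>v \<in> refl_group I. weyl_length \<Delta> w \<le> weyl_length \<Delta> (w \<circ> v)}"

end

(* Strong exchange, applied to reduced words, shows that for a positive root beta one has
   l(w s_beta) > l(w) iff w(beta) > 0, so steps of both orders are governed by signs of roots.
   Right multiplication by v in W_P turns a step along alpha into a step along v^-1(alpha), and W_P
   permutes R^+ - R_P^+; this gives (1) => (2), and it reduces (3) => (1) to the claim that u <= w
   with w in W^P implies u <=_P w.  The claim follows by induction on l(w).  Choose a simple s with
   sw < w; then sw lies in W^P and sw -> w is a step of the P-order.  Left multiplication by s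
   preserves every step except x -> sx, so u <= w gives su <= sw or u <= sw; induction turns these
   into su <=_P sw or u <=_P sw, and in either case u <=_P w. *)
theory Submission
  imports Defs
begin

section \<open>Reflections and the groups they generate\<close>

lemma reflection_self: "reflection \<alpha> \<alpha> = - \<alpha>"
  by (cases "\<alpha> = 0") (simp_all add: reflection_def scaleR_2)

lemma reflection_uminus: "reflection (- \<alpha>) = reflection \<alpha>"
  by (rule ext) (simp add: reflection_def)

lemma orthogonal_transformation_reflection:
  "orthogonal_transformation (reflection \<alpha>)"
proof (cases "\<alpha> = 0")
  case True
  then have "reflection \<alpha> = (\<lambda>x. x)"
    by (auto simp: reflection_def)
  then show ?thesis
    by (simp add: orthogonal_transformation_def)
next
  case False
  have "linear (reflection \<alpha>)"
    unfolding reflection_def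
    by (intro linearI)
      (simp_all add: algebra_simps inner_add_left add_divide_distrib scaleR_add_left)
  moreover have "reflection \<alpha> x \<bullet> reflection \<alpha> y = x \<bullet> y" for x y
    using False
    by (simp add: reflection_def inner_diff_left inner_diff_right inner_commute field_simps)
  ultimately show ?thesis
    by (simp add: orthogonal_transformation_def)
qed

text \<open>\<open>g\<close> is linear and preserves inner products, so the coefficient in
  \<open>reflection \<beta> x\<close> equals the one in \<open>reflection (g \<beta>) (g x)\<close>.
  This is the exchange rule between multiplying by a reflection on the right and on the
  left.\<close>

lemma reflection_conj:
  assumes "orthogonal_transformation g"
  shows "g \<circ> reflection \<beta> = reflection (g \<beta>) \<circ> g"
  using assms
  by (auto simp: fun_eq_iff reflection_def orthogonal_transformation_def linear_diff linear_cmul)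

lemma reflection_invol: "reflection \<alpha> \<circ> reflection \<alpha> = id"
proof (cases "\<alpha> = 0")
  case False
  then show ?thesis
    by (simp add: fun_eq_iff reflection_def inner_diff_left algebra_simps flip: scaleR_add_left)
qed (simp add: fun_eq_iff reflection_def)

lemma reflection_reflection: "reflection \<alpha> (reflection \<alpha> x) = x"
  using reflection_invol[of \<alpha>] by (simp add: fun_eq_iff)

lemma refl_word_Nil [simp]: "refl_word [] = id"
  by (simp add: refl_word_def)

lemma refl_word_Cons [simp]: "refl_word (\<alpha> # as) = reflection \<alpha> \<circ> refl_word as"
  by (simp add: refl_word_def)

lemma refl_word_append: "refl_word (as @ bs) = refl_word as \<circ> refl_word bs"
  by (induction as) (simp_all add: comp_assoc)

lemma refl_word_rev: "refl_word (rev as) \<circ> refl_word as = id"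
proof (induction as)
  case (Cons a as)
  then show ?case
    by (simp add: refl_word_append fun_eq_iff reflection_reflection)
qed simp

lemma refl_group_id: "id \<in> refl_group S"
  unfolding refl_group_def using refl_word_Nil by (metis image_eqI lists.Nil)

lemma refl_group_comp:
  assumes "g \<in> refl_group S" "h \<in> refl_group S"
  shows "g \<circ> h \<in> refl_group S"
proof -
  from assms obtain as bs where "as \<in> lists S" "bs \<in> lists S" "g = refl_word as" "h = refl_word bs"
    by (auto simp: refl_group_def)
  then have "g \<circ> h = refl_word (as @ bs)" "as @ bs \<in> lists S"
    by (auto simp: refl_word_append)
  then show ?thesis
    unfolding refl_group_def by blast
qed

lemma refl_group_reflection: "\<alpha> \<in> S \<Longrightarrow> reflection \<alpha> \<in> refl_group S"
  unfolding refl_group_def by (rule image_eqI[of _ _ "[\<alpha>]"]) auto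

lemma refl_group_inverse:
  assumes "g \<in> refl_group S"
  obtains h where "h \<in> refl_group S" "g \<circ> h = id" "h \<circ> g = id"
proof -
  from assms obtain as where as: "as \<in> lists S" "g = refl_word as"
    by (auto simp: refl_group_def)
  have "refl_word (rev as) \<in> refl_group S"
    using as unfolding refl_group_def by auto
  moreover have "refl_word (rev as) \<circ> g = id" "g \<circ> refl_word (rev as) = id"
    using refl_word_rev[of as] refl_word_rev[of "rev as"] as by simp_all
  ultimately show ?thesis
    using that by blast
qed

text \<open>Induction principle for a group generated by reflections, with a set \<open>G\<close> in
  the role of the predicate. Its instances below are orthogonality, stability of \<open>R\<close>,
  and stability of the positive roots outside the parabolic.\<close>

lemma refl_group_closed:
  assumes "w \<in> refl_group S" "id \<in> G" "\<And>\<alpha> g. \<alpha> \<in> S \<Longrightarrow> g \<in> G \<Longrightarrow> reflection \<alpha> \<circ> g \<in> G"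
  shows "w \<in> G"
proof -
  from assms(1) obtain as where as: "as \<in> lists S" "w = refl_word as"
    by (auto simp: refl_group_def)
  from as(1) have "refl_word as \<in> G"
    using assms(2,3) by (induction rule: lists.induct) simp_all
  with as show ?thesis by simp
qed

lemma refl_group_subset:
  assumes "\<And>\<alpha>. \<alpha> \<in> S \<Longrightarrow> reflection \<alpha> \<in> refl_group T"
  shows "refl_group S \<subseteq> refl_group T"
  using refl_group_closed[of _ S "refl_group T"] assms refl_group_id refl_group_comp by blast

lemma orthogonal_refl_group:
  assumes "w \<in> refl_group S"
  shows "orthogonal_transformation w"
  using refl_group_closed[OF assms, of "Collect orthogonal_transformation"]
    orthogonal_transformation_reflection orthogonal_transformation_compose
  by (auto simp: orthogonal_transformation_id[unfolded id_def[symmetric]] id_def)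

lemma refl_group_neg:
  assumes "w \<in> refl_group S"
  shows "w (- x) = - w x"
  using orthogonal_refl_group[OF assms] by (simp add: orthogonal_transformation_def linear_neg)

section \<open>Coordinates of roots and the action of simple reflections on them\<close>

locale root_basis =
  fixes R \<Delta> :: "'a::euclidean_space set"
  assumes root_system: "root_system R"
    and simple_roots: "simple_roots R \<Delta>"
begin

text \<open>This coordinate function is 0 at every vector outside \<open>\<Delta>\<close>, so sign
  conditions on a root can be quantified over all vectors.\<close>

abbreviation coef :: "'a \<Rightarrow> 'a \<Rightarrow> real" where
  "coef \<equiv> real_vector.representation \<Delta>"

lemma finite_R: "finite R"
  and root_nonzero: "0 \<notin> R"
  and scale_root: "\<alpha> \<in> R \<Longrightarrow> c *\<^sub>R \<alpha> \<in> R \<longleftrightarrow> c = 1 \<or> c = -1"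
  using root_system by (auto simp: root_system_def)

lemma reflection_root: "\<alpha> \<in> R \<Longrightarrow> \<beta> \<in> R \<Longrightarrow> reflection \<alpha> \<beta> \<in> R"
  using root_system unfolding root_system_def by blast

lemma neg_root: "\<alpha> \<in> R \<Longrightarrow> - \<alpha> \<in> R"
  using scale_root[of \<alpha> "-1"] by simp

lemma simple_in_R: "\<Delta> \<subseteq> R"
  and indep: "independent \<Delta>"
  using simple_roots by (auto simp: simple_roots_def)

lemma finite_simple: "finite \<Delta>"
  using simple_in_R finite_R finite_subset by blast

lemma coef_sum:
  assumes "I \<subseteq> \<Delta>"
  shows "coef (\<Sum>\<alpha>\<in>I. f \<alpha> *\<^sub>R \<alpha>) \<gamma> = (if \<gamma> \<in> I then f \<gamma> else 0)"
proof -
  have fin: "finite I"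
    using assms finite_simple finite_subset by blast
  have "coef (\<Sum>\<alpha>\<in>I. f \<alpha> *\<^sub>R \<alpha>) = (\<lambda>\<gamma>. \<Sum>\<alpha>\<in>I. coef (f \<alpha> *\<^sub>R \<alpha>) \<gamma>)"
    using assms indep
    by (intro real_vector.representation_sum) (auto intro!: span_scale intro: span_base)
  also have "\<dots> = (\<lambda>\<gamma>. \<Sum>\<alpha>\<in>I. if \<alpha> = \<gamma> then f \<alpha> else 0)"
    using assms indep
    by (intro ext sum.cong)
      (auto simp: real_vector.representation_scale real_vector.representation_basis real_vector.span_base subset_iff)
  finally show ?thesis
    using fin by simp
qed

lemma root_expansion:
  assumes "\<beta> \<in> R"
  obtains c :: "'a \<Rightarrow> int" where "\<beta> = (\<Sum>\<alpha>\<in>\<Delta>. of_int (c \<alpha>) *\<^sub>R \<alpha>)"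
    and "(\<forall>\<alpha>\<in>\<Delta>. 0 \<le> c \<alpha>) \<or> (\<forall>\<alpha>\<in>\<Delta>. c \<alpha> \<le> 0)"
  using simple_roots assms unfolding simple_roots_def by blast

lemma root_in_span: "\<beta> \<in> R \<Longrightarrow> \<beta> \<in> span \<Delta>"
  by (erule root_expansion) (simp add: span_sum span_scale span_base)

lemma coef_sign:
  assumes "\<beta> \<in> R"
  shows "(\<forall>\<alpha>. 0 \<le> coef \<beta> \<alpha>) \<or> (\<forall>\<alpha>. coef \<beta> \<alpha> \<le> 0)"
proof -
  from assms obtain c :: "'a \<Rightarrow> int" where c: "\<beta> = (\<Sum>\<alpha>\<in>\<Delta>. of_int (c \<alpha>) *\<^sub>R \<alpha>)"
    "(\<forall>\<alpha>\<in>\<Delta>. 0 \<le> c \<alpha>) \<or> (\<forall>\<alpha>\<in>\<Delta>. c \<alpha> \<le> 0)"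
    by (rule root_expansion)
  have "coef \<beta> \<alpha> = (if \<alpha> \<in> \<Delta> then of_int (c \<alpha>) else 0)" for \<alpha>
    unfolding c(1) by (rule coef_sum) simp
  with c(2) show ?thesis
    by auto
qed

text \<open>Coordinates are unique because \<open>\<Delta>\<close> is independent, so the
  existential over natural coefficients becomes a condition on signs and support. In the converse
  direction integrality comes from the expansion that \<open>simple_roots\<close>
  guarantees.\<close>

lemma pos_roots_iff:
  assumes "I \<subseteq> \<Delta>"
  shows "\<beta> \<in> pos_roots R I \<longleftrightarrow> \<beta> \<in> R \<and> (\<forall>\<alpha>. 0 \<le> coef \<beta> \<alpha>) \<and> (\<forall>\<alpha>. \<alpha> \<notin> I \<longrightarrow> coef \<beta> \<alpha> = 0)"
proof (intro iffI conjI; (elim conjE)?)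
  assume "\<beta> \<in> pos_roots R I"
  then obtain c :: "'a \<Rightarrow> nat" where c: "\<beta> = (\<Sum>\<alpha>\<in>I. of_nat (c \<alpha>) *\<^sub>R \<alpha>)" and "\<beta> \<in> R"
    by (auto simp: pos_roots_def)
  have "coef \<beta> \<alpha> = (if \<alpha> \<in> I then of_nat (c \<alpha>) else 0)" for \<alpha>
    unfolding c by (rule coef_sum) fact
  with \<open>\<beta> \<in> R\<close> show "\<beta> \<in> R" "\<forall>\<alpha>. 0 \<le> coef \<beta> \<alpha>" "\<forall>\<alpha>. \<alpha> \<notin> I \<longrightarrow> coef \<beta> \<alpha> = 0"
    by auto
next
  assume \<beta>: "\<beta> \<in> R" "\<forall>\<alpha>. 0 \<le> coef \<beta> \<alpha>" "\<forall>\<alpha>. \<alpha> \<notin> I \<longrightarrow> coef \<beta> \<alpha> = 0"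
  from \<beta>(1) obtain c :: "'a \<Rightarrow> int" where c: "\<beta> = (\<Sum>\<alpha>\<in>\<Delta>. of_int (c \<alpha>) *\<^sub>R \<alpha>)"
    by (rule root_expansion)
  have coef: "coef \<beta> \<alpha> = (if \<alpha> \<in> \<Delta> then of_int (c \<alpha>) else 0)" for \<alpha>
    unfolding c by (rule coef_sum) simp
  have "\<beta> = (\<Sum>\<alpha>\<in>I. of_int (c \<alpha>) *\<^sub>R \<alpha>)"
    unfolding c
  proof (intro sum.mono_neutral_right finite_simple assms ballI)
    fix \<alpha> assume "\<alpha> \<in> \<Delta> - I"
    then show "of_int (c \<alpha>) *\<^sub>R \<alpha> = 0"
      using coef[of \<alpha>] \<beta>(3) by simp
  qed
  also have "\<dots> = (\<Sum>\<alpha>\<in>I. of_nat (nat (c \<alpha>)) *\<^sub>R \<alpha>)"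
  proof (intro sum.cong refl)
    fix \<alpha> assume "\<alpha> \<in> I"
    then have "0 \<le> c \<alpha>"
      using assms \<beta>(2)[rule_format, of \<alpha>] coef[of \<alpha>] by auto
    then show "of_int (c \<alpha>) *\<^sub>R \<alpha> = of_nat (nat (c \<alpha>)) *\<^sub>R \<alpha>"
      by simp
  qed
  finally have "\<exists>c :: 'a \<Rightarrow> nat. \<beta> = (\<Sum>\<alpha>\<in>I. of_nat (c \<alpha>) *\<^sub>R \<alpha>)"
    by (rule exI[of _ "\<lambda>\<alpha>. nat (c \<alpha>)"])
  with \<beta>(1) show "\<beta> \<in> pos_roots R I"
    unfolding pos_roots_def by blast
qed

lemma coef_outside: "\<alpha> \<notin> \<Delta> \<Longrightarrow> coef \<beta> \<alpha> = 0"
  using real_vector.representation_ne_zero by blast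

lemma pos_root_iff: "\<beta> \<in> pos_roots R \<Delta> \<longleftrightarrow> \<beta> \<in> R \<and> (\<forall>\<alpha>. 0 \<le> coef \<beta> \<alpha>)"
  by (auto simp: pos_roots_iff coef_outside)

lemma coef_neg: "\<beta> \<in> R \<Longrightarrow> coef (- \<beta>) \<alpha> = - coef \<beta> \<alpha>"
  using real_vector.representation_neg[OF indep root_in_span] by simp

lemma simple_pos: "\<alpha> \<in> I \<Longrightarrow> I \<subseteq> \<Delta> \<Longrightarrow> \<alpha> \<in> pos_roots R I"
  using simple_in_R indep by (auto simp: pos_roots_iff real_vector.representation_basis)

lemma pos_or_neg: "\<beta> \<in> R \<Longrightarrow> \<beta> \<in> pos_roots R \<Delta> \<or> - \<beta> \<in> pos_roots R \<Delta>"
  using coef_sign by (fastforce simp: pos_root_iff neg_root coef_neg)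

lemma root_eq_sum_coef: "\<beta> \<in> R \<Longrightarrow> (\<Sum>\<alpha>\<in>\<Delta>. coef \<beta> \<alpha> *\<^sub>R \<alpha>) = \<beta>"
  using real_vector.sum_representation_eq[OF indep root_in_span finite_simple] by simp

lemma not_pos_and_neg:
  assumes "\<beta> \<in> pos_roots R \<Delta>"
  shows "- \<beta> \<notin> pos_roots R \<Delta>"
proof
  assume "- \<beta> \<in> pos_roots R \<Delta>"
  with assms have "coef \<beta> \<alpha> = 0" for \<alpha>
    by (smt (verit) pos_root_iff coef_neg)
  with assms root_eq_sum_coef[of \<beta>] root_nonzero show False
    by (auto simp: pos_root_iff)
qed

lemma coef_reflection_simple:
  assumes "\<alpha> \<in> \<Delta>" "\<beta> \<in> R"
  shows "coef (reflection \<alpha> \<beta>) \<gamma> =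
    coef \<beta> \<gamma> - (if \<gamma> = \<alpha> then 2 * (\<beta> \<bullet> \<alpha>) / (\<alpha> \<bullet> \<alpha>) else 0)"
  using assms indep unfolding reflection_def
  by (simp add: real_vector.representation_diff real_vector.representation_scale
      real_vector.representation_basis root_in_span span_base span_scale)

text \<open>Reflecting in \<open>\<alpha>\<close> changes only the coordinate at
  \<open>\<alpha>\<close>. As \<open>R\<close> is reduced, \<open>\<beta>\<close> is not a multiple
  of \<open>\<alpha>\<close> and has a positive coordinate elsewhere. That coordinate survives, and
  the coordinates of a root never have mixed signs.\<close>

lemma reflection_simple_pos:
  assumes "I \<subseteq> \<Delta>" "\<alpha> \<in> I" "\<beta> \<in> pos_roots R I" "\<beta> \<noteq> \<alpha>"
  shows "reflection \<alpha> \<beta> \<in> pos_roots R I"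
proof -
  have \<beta>: "\<beta> \<in> R" "\<And>\<gamma>. 0 \<le> coef \<beta> \<gamma>" "\<And>\<gamma>. \<gamma> \<notin> I \<Longrightarrow> coef \<beta> \<gamma> = 0"
    using assms by (auto simp: pos_roots_iff)
  have \<alpha>: "\<alpha> \<in> \<Delta>" "\<alpha> \<in> R"
    using assms simple_in_R by auto
  note coefs = coef_reflection_simple[OF \<alpha>(1) \<beta>(1)]
  have "\<exists>\<gamma>. \<gamma> \<noteq> \<alpha> \<and> coef \<beta> \<gamma> \<noteq> 0"
  proof (rule ccontr)
    assume "\<not> ?thesis"
    then have "\<And>\<gamma>. \<gamma> \<noteq> \<alpha> \<Longrightarrow> coef \<beta> \<gamma> = 0"
      by blast
    then have "(\<Sum>\<gamma>\<in>\<Delta>. coef \<beta> \<gamma> *\<^sub>R \<gamma>) = (\<Sum>\<gamma>\<in>{\<alpha>}. coef \<beta> \<gamma> *\<^sub>R \<gamma>)"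
      using \<alpha> finite_simple by (intro sum.mono_neutral_right) auto
    then have "\<beta> = coef \<beta> \<alpha> *\<^sub>R \<alpha>"
      using root_eq_sum_coef[OF \<beta>(1)] by simp
    \<comment> \<open>Reducedness leaves only the scalars 1 and -1, and \<open>\<beta>\<close> has
      nonnegative coordinates.\<close>
    moreover from this have "coef \<beta> \<alpha> = 1"
      using scale_root[OF \<alpha>(2), of "coef \<beta> \<alpha>"] \<beta>(1) \<beta>(2)[of \<alpha>] by force
    ultimately show False
      using assms(4) by simp
  qed
  then obtain \<gamma> where "\<gamma> \<noteq> \<alpha>" "0 < coef \<beta> \<gamma>"
    using \<beta>(2) by (metis order_le_less)
  then have "0 < coef (reflection \<alpha> \<beta>) \<gamma>"
    by (simp add: coefs)
  with coef_sign[OF reflection_root[OF \<alpha>(2) \<beta>(1)]]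
  have "\<forall>\<gamma>. 0 \<le> coef (reflection \<alpha> \<beta>) \<gamma>"
    by (meson not_le)
  then show ?thesis
    using reflection_root[OF \<alpha>(2) \<beta>(1)] \<beta>(3) assms(2) by (auto simp: pos_roots_iff[OF assms(1)] coefs)
qed

text \<open>Induction on the height \<open>sum (coef \<beta>) \<Delta>\<close>. If
  \<open>\<beta>\<close> is not in \<open>I\<close>, some \<open>\<alpha>\<close> in
  \<open>I\<close> has positive inner product with it; reflecting in \<open>\<alpha>\<close> gives a
  positive root of smaller height, whose reflection is conjugate to that of \<open>\<beta>\<close>
  by \<open>reflection \<alpha>\<close>.\<close>

lemma reflection_pos_root_in_refl_group:
  assumes "I \<subseteq> \<Delta>" "\<beta> \<in> pos_roots R I"
  shows "reflection \<beta> \<in> refl_group I"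
  using assms(2)
\<comment> \<open>The height is real-valued, so the measure counts the finitely many roots of
  smaller height instead.\<close>
proof (induction "card {\<gamma> \<in> R. sum (coef \<gamma>) \<Delta> < sum (coef \<beta>) \<Delta>}" arbitrary: \<beta> rule: less_induct)
  case less
  show ?case
  proof (cases "\<beta> \<in> I")
    case True
    then show ?thesis
      by (rule refl_group_reflection)
  next
    case False
    have \<beta>: "\<beta> \<in> R" "\<And>\<gamma>. 0 \<le> coef \<beta> \<gamma>" "\<And>\<gamma>. \<gamma> \<notin> I \<Longrightarrow> coef \<beta> \<gamma> = 0"
      using less.prems assms(1) by (auto simp: pos_roots_iff)
    \<comment> \<open>Expanding one factor in simple roots writes a positive number as a sum, so
      some summand is positive. Its \<open>\<alpha>\<close> lies in \<open>I\<close> because the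
      other coordinates of \<open>\<beta>\<close> vanish.\<close>
    have "0 < \<beta> \<bullet> \<beta>"
      using \<beta>(1) root_nonzero by auto
    also have "\<beta> \<bullet> \<beta> = (\<Sum>\<alpha>\<in>\<Delta>. coef \<beta> \<alpha> * (\<beta> \<bullet> \<alpha>))"
      by (subst (2) root_eq_sum_coef[OF \<beta>(1), symmetric]) (simp add: inner_sum_right)
    finally obtain \<alpha> where \<alpha>: "\<alpha> \<in> \<Delta>" "0 < coef \<beta> \<alpha> * (\<beta> \<bullet> \<alpha>)"
      by (meson not_le sum_nonpos)
    then have "0 < \<beta> \<bullet> \<alpha>"
      using \<beta>(2)[of \<alpha>] by (simp add: zero_less_mult_iff)
    have "\<alpha> \<in> I"
      using \<alpha>(2) \<beta>(3)[of \<alpha>] by force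
    let ?\<gamma> = "reflection \<alpha> \<beta>"
    have pos: "?\<gamma> \<in> pos_roots R I"
      using reflection_simple_pos[OF assms(1) \<open>\<alpha> \<in> I\<close> less.prems] False \<open>\<alpha> \<in> I\<close> by blast
    have "0 < \<alpha> \<bullet> \<alpha>"
      using \<alpha>(1) simple_in_R root_nonzero by auto
    then have "sum (coef ?\<gamma>) \<Delta> < sum (coef \<beta>) \<Delta>"
      using \<alpha>(1) finite_simple \<open>0 < \<beta> \<bullet> \<alpha>\<close>
      by (simp add: coef_reflection_simple[OF \<alpha>(1) \<beta>(1)] sum_subtractf)
    then have "{\<gamma> \<in> R. sum (coef \<gamma>) \<Delta> < sum (coef ?\<gamma>) \<Delta>} \<subset> {\<gamma> \<in> R. sum (coef \<gamma>) \<Delta> < sum (coef \<beta>) \<Delta>}"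
      using pos assms(1) by (auto simp: pos_roots_iff)
    then have IH: "reflection ?\<gamma> \<in> refl_group I"
      using finite_R pos by (intro less.hyps psubset_card_mono) simp_all
    have "reflection \<beta> = reflection \<alpha> \<circ> reflection ?\<gamma> \<circ> reflection \<alpha>"
      using reflection_conj[OF orthogonal_transformation_reflection, of \<alpha> ?\<gamma>]
      by (simp add: reflection_reflection comp_assoc reflection_invol)
    also have "\<dots> \<in> refl_group I"
      using IH refl_group_reflection[OF \<open>\<alpha> \<in> I\<close>] by (intro refl_group_comp)
    finally show ?thesis .
  qed
qed

section \<open>The Weyl group, its length function and strong exchange\<close>

lemma refl_group_root_eq: "refl_group R = refl_group \<Delta>"
proof (intro antisym refl_group_subset)
  fix \<alpha> assume "\<alpha> \<in> R"
  then show "reflection \<alpha> \<in> refl_group \<Delta>"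
    using pos_or_neg reflection_pos_root_in_refl_group[of \<Delta>] by (metis order_refl reflection_uminus)
next
  fix \<alpha> assume "\<alpha> \<in> \<Delta>"
  then show "reflection \<alpha> \<in> refl_group R"
    using simple_in_R by (auto intro: refl_group_reflection)
qed

lemma refl_group_root: "w \<in> refl_group R \<Longrightarrow> \<beta> \<in> R \<Longrightarrow> w \<beta> \<in> R"
  using refl_group_closed[of w R "{g. \<forall>\<beta>\<in>R. g \<beta> \<in> R}"] reflection_root by auto

lemma refl_group_parabolic: "I \<subseteq> \<Delta> \<Longrightarrow> v \<in> refl_group I \<Longrightarrow> v \<in> refl_group R"
  using refl_group_subset[of I R] refl_group_reflection simple_in_R by blast

lemma weyl_length_le: "as \<in> lists \<Delta> \<Longrightarrow> weyl_length \<Delta> (refl_word as) \<le> length as"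
  unfolding weyl_length_def by (rule Least_le) blast

text \<open>The \<open>LEAST\<close> in \<open>weyl_length\<close> ranges over words in simple
  roots; such a word for \<open>w\<close> exists because \<open>R\<close> and
  \<open>\<Delta>\<close> generate the same group.\<close>

lemma reduced_word:
  assumes "w \<in> refl_group R"
  obtains as where "as \<in> lists \<Delta>" "refl_word as = w" "length as = weyl_length \<Delta> w"
proof -
  have "w \<in> refl_group \<Delta>"
    using assms refl_group_root_eq by simp
  then have "\<exists>n. \<exists>as\<in>lists \<Delta>. length as = n \<and> refl_word as = w"
    unfolding refl_group_def by blast
  from LeastI_ex[OF this] show ?thesis
    using that unfolding weyl_length_def by blast
qed

lemma weyl_length_reflection_le:
  assumes "\<alpha> \<in> \<Delta>" "w \<in> refl_group R"
  shows "weyl_length \<Delta> (reflection \<alpha> \<circ> w) \<le> Suc (weyl_length \<Delta> w)"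
proof -
  from assms(2) obtain as where as: "as \<in> lists \<Delta>" "refl_word as = w" "length as = weyl_length \<Delta> w"
    by (rule reduced_word)
  then show ?thesis
    using weyl_length_le[of "\<alpha> # as"] assms(1) by simp
qed

text \<open>Let the letters act on \<open>\<beta>\<close> from the right end of the word. At the
  letter \<open>a\<close> where the image first stops being positive, the image before it must be
  \<open>a\<close> itself, since \<open>reflection a\<close> keeps all other positive roots
  positive. Moving \<open>reflection \<beta>\<close> leftwards past the letters to the right of
  \<open>a\<close> turns it into \<open>reflection a\<close>, which cancels that letter.\<close>

lemma strong_exchange:
  assumes "as \<in> lists \<Delta>" "\<beta> \<in> pos_roots R \<Delta>" "refl_word as \<beta> \<notin> pos_roots R \<Delta>"
  shows "\<exists>bs\<in>lists \<Delta>. length bs < length as \<and> refl_word as \<circ> reflection \<beta> = refl_word bs"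
  using assms(1,3)
proof (induction as)
  case Nil
  with assms(2) show ?case by simp
next
  case (Cons a as)
  show ?case
  proof (cases "refl_word as \<beta> \<in> pos_roots R \<Delta>")
    case True
    then have a: "refl_word as \<beta> = a"
      using reflection_simple_pos[of \<Delta> a] Cons by auto
    have "orthogonal_transformation (refl_word as)"
      using Cons.hyps by (auto intro!: orthogonal_refl_group simp: refl_group_def)
    then have "refl_word as \<circ> reflection \<beta> = reflection a \<circ> refl_word as"
      using reflection_conj a by metis
    then have "refl_word (a # as) \<circ> reflection \<beta> = refl_word as"
      by (simp add: comp_assoc) (simp add: reflection_invol flip: comp_assoc)
    moreover have "length as < length (a # as)"
      by simp
    ultimately show ?thesis
      using Cons.hyps(2) by (intro bexI conjI)
  next
    case False
    from Cons.IH[OF False] obtain bs where "bs \<in> lists \<Delta>" "length bs < length as"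
      "refl_word as \<circ> reflection \<beta> = refl_word bs"
      by blast
    then have "a # bs \<in> lists \<Delta>" "length (a # bs) < length (a # as)"
      "refl_word (a # as) \<circ> reflection \<beta> = refl_word (a # bs)"
      using Cons.hyps(1) by (simp_all only: lists.Cons length_Cons Suc_less_eq refl_word_Cons comp_assoc)
    then show ?thesis by (intro bexI conjI)
  qed
qed

text \<open>Exchange on a reduced word gives the decrease when the image of \<open>\<beta>\<close>
  is not positive. The increase is the same fact for \<open>w \<circ> reflection \<beta>\<close>,
  which sends \<open>\<beta>\<close> to \<open>- w \<beta>\<close>.\<close>

lemma weyl_length_less_iff:
  assumes w: "w \<in> refl_group R" and \<beta>: "\<beta> \<in> pos_roots R \<Delta>"
  shows "weyl_length \<Delta> w < weyl_length \<Delta> (w \<circ> reflection \<beta>) \<longleftrightarrow> w \<beta> \<in> pos_roots R \<Delta>"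
proof -
  have decrease: "weyl_length \<Delta> (g \<circ> reflection \<beta>) < weyl_length \<Delta> g"
    if "g \<in> refl_group R" "g \<beta> \<notin> pos_roots R \<Delta>" for g
  proof -
    from that(1) obtain as where as: "as \<in> lists \<Delta>" "refl_word as = g" "length as = weyl_length \<Delta> g"
      by (rule reduced_word)
    with strong_exchange[OF as(1) \<beta>] that(2) obtain bs where
      "bs \<in> lists \<Delta>" "length bs < length as" "g \<circ> reflection \<beta> = refl_word bs"
      by auto
    with weyl_length_le[of bs] as show ?thesis by simp
  qed
  have \<beta>R: "\<beta> \<in> R"
    using \<beta> by (simp add: pos_root_iff)
  have "weyl_length \<Delta> w < weyl_length \<Delta> (w \<circ> reflection \<beta>)" if pos: "w \<beta> \<in> pos_roots R \<Delta>"
  proof -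
    have "(w \<circ> reflection \<beta>) \<beta> = - w \<beta>"
      using refl_group_neg[OF w] by (simp add: reflection_self)
    then show ?thesis
      using decrease[of "w \<circ> reflection \<beta>"] not_pos_and_neg[OF pos]
        refl_group_comp[OF w refl_group_reflection[OF \<beta>R]]
      by (simp add: comp_assoc reflection_invol)
  qed
  with decrease[OF w] show ?thesis
    using less_asym by blast
qed

section \<open>Steps and chains under left and right multiplication\<close>

lemma refl_step_iff:
  assumes "A \<subseteq> pos_roots R \<Delta>"
  shows "refl_step R \<Delta> A x y \<longleftrightarrow>
    x \<in> refl_group R \<and> (\<exists>\<alpha>\<in>A. y = x \<circ> reflection \<alpha> \<and> x \<alpha> \<in> pos_roots R \<Delta>)"
proof -
  have "weyl_length \<Delta> x < weyl_length \<Delta> y \<longleftrightarrow> x \<alpha> \<in> pos_roots R \<Delta>"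
    if "x \<in> refl_group R" "\<alpha> \<in> A" "y = x \<circ> reflection \<alpha>" for \<alpha>
    unfolding that(3) using that(1,2) assms by (intro weyl_length_less_iff) auto
  then show ?thesis
    unfolding refl_step_def by blast
qed

text \<open>The translated step keeps its label \<open>\<alpha>\<close>, and the root whose sign
  decides it becomes \<open>reflection a (x \<alpha>)\<close>. This is positive unless
  \<open>x \<alpha> = a\<close>, and then the step itself is left multiplication by
  \<open>reflection a\<close>. Leaving \<open>A\<close> general covers both orders at once.\<close>

lemma refl_step_left:
  assumes A: "A \<subseteq> pos_roots R \<Delta>" and a: "a \<in> \<Delta>" and step: "refl_step R \<Delta> A x y"
  shows "y = reflection a \<circ> x \<or> refl_step R \<Delta> A (reflection a \<circ> x) (reflection a \<circ> y)"
proof -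
  from step obtain \<alpha> where \<alpha>: "x \<in> refl_group R" "\<alpha> \<in> A" "y = x \<circ> reflection \<alpha>" "x \<alpha> \<in> pos_roots R \<Delta>"
    by (auto simp: refl_step_iff[OF A])
  show ?thesis
  proof (cases "x \<alpha> = a")
    case True
    then show ?thesis
      using reflection_conj[OF orthogonal_refl_group[OF \<alpha>(1)]] \<alpha>(3) by metis
  next
    case False
    then have "reflection a (x \<alpha>) \<in> pos_roots R \<Delta>"
      using reflection_simple_pos a \<alpha>(4) by blast
    moreover have "reflection a \<circ> x \<in> refl_group R"
      using a simple_in_R \<alpha>(1) by (auto intro!: refl_group_comp refl_group_reflection)
    ultimately show ?thesis
      using \<alpha> unfolding refl_step_iff[OF A] by (auto simp: comp_assoc)
  qed
qed

text \<open>Translate the chain step by step from its start. At an exceptional step the next element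
  is already \<open>reflection a \<circ> x\<close>, so the rest of the original chain, followed by
  the step up from \<open>y\<close>, finishes.\<close>

lemma chain_left_mult:
  assumes A: "A \<subseteq> pos_roots R \<Delta>" and a: "a \<in> \<Delta>"
    and chain: "(refl_step R \<Delta> A)\<^sup>*\<^sup>* x y" and y: "refl_step R \<Delta> A y (reflection a \<circ> y)"
  shows "(refl_step R \<Delta> A)\<^sup>*\<^sup>* (reflection a \<circ> x) (reflection a \<circ> y)"
  using chain
proof (induction rule: converse_rtranclp_induct)
  case (step x x')
  from refl_step_left[OF A a step.hyps(1)] show ?case
  proof
    assume "x' = reflection a \<circ> x"
    then show ?thesis
      using step.hyps(2) y by (simp only: rtranclp.rtrancl_into_rtrancl)
  next
    assume "refl_step R \<Delta> A (reflection a \<circ> x) (reflection a \<circ> x')"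
    then show ?thesis
      using step.IH by (rule converse_rtranclp_into_rtranclp)
  qed
qed (rule rtranclp.rtrancl_refl)

text \<open>Suppose the rest of the chain, starting at \<open>x'\<close>, has been translated. If
  the step before it is exceptional, then \<open>reflection a \<circ> x' = x\<close>, so the
  translated rest is a chain from \<open>x\<close> to \<open>reflection a \<circ> y\<close>; any
  other step is translated as well.\<close>

lemma chain_left_cases:
  assumes A: "A \<subseteq> pos_roots R \<Delta>" and a: "a \<in> \<Delta>" and chain: "(refl_step R \<Delta> A)\<^sup>*\<^sup>* x y"
  shows "(refl_step R \<Delta> A)\<^sup>*\<^sup>* (reflection a \<circ> x) (reflection a \<circ> y)
       \<or> (refl_step R \<Delta> A)\<^sup>*\<^sup>* x (reflection a \<circ> y)"
  using chain
proof (induction rule: converse_rtranclp_induct)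
  case (step x x')
  from step.IH show ?case
  proof
    assume *: "(refl_step R \<Delta> A)\<^sup>*\<^sup>* (reflection a \<circ> x') (reflection a \<circ> y)"
    from refl_step_left[OF A a step.hyps(1)] show ?thesis
    proof
      assume "x' = reflection a \<circ> x"
      then have "reflection a \<circ> x' = x"
        by (simp add: fun_eq_iff reflection_reflection)
      with * show ?thesis by (simp only: simp_thms)
    next
      assume "refl_step R \<Delta> A (reflection a \<circ> x) (reflection a \<circ> x')"
      from converse_rtranclp_into_rtranclp[of "refl_step R \<Delta> A", OF this *]
      show ?thesis by (rule disjI1)
    qed
  next
    assume "(refl_step R \<Delta> A)\<^sup>*\<^sup>* x' (reflection a \<circ> y)"
    from converse_rtranclp_into_rtranclp[of "refl_step R \<Delta> A", OF step.hyps(1) this]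
    show ?thesis by (rule disjI2)
  qed
qed (intro disjI1 rtranclp.rtrancl_refl)

text \<open>It suffices to reflect in a single \<open>\<alpha>\<close> in \<open>I\<close>. The
  image of \<open>\<gamma>\<close> stays positive as \<open>\<gamma> \<noteq> \<alpha>\<close>. Were
  it in \<open>pos_roots R I\<close>, reflecting back would put \<open>\<gamma>\<close> there too;
  the exception, image equal to \<open>\<alpha>\<close>, would force
  \<open>\<gamma> = - \<alpha>\<close>.\<close>

lemma complement_parabolic_closed:
  assumes I: "I \<subseteq> \<Delta>" and v: "v \<in> refl_group I" and \<beta>: "\<beta> \<in> pos_roots R \<Delta> - pos_roots R I"
  shows "v \<beta> \<in> pos_roots R \<Delta> - pos_roots R I"
proof -
  have "reflection \<alpha> \<gamma> \<in> pos_roots R \<Delta> - pos_roots R I"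
    if \<alpha>: "\<alpha> \<in> I" and \<gamma>: "\<gamma> \<in> pos_roots R \<Delta> - pos_roots R I" for \<alpha> \<gamma>
  proof -
    have "\<gamma> \<noteq> \<alpha>"
      using \<alpha> \<gamma> I simple_pos by blast
    then have pos: "reflection \<alpha> \<gamma> \<in> pos_roots R \<Delta>"
      using reflection_simple_pos[of \<Delta> \<alpha> \<gamma>] \<alpha> \<gamma> I by blast
    have "reflection \<alpha> \<gamma> \<noteq> \<alpha>"
      using not_pos_and_neg[of \<alpha>] simple_pos[of \<alpha> \<Delta>] \<alpha> \<gamma> I
      by (metis DiffD1 order_refl reflection_reflection reflection_self subsetD)
    then have "reflection \<alpha> \<gamma> \<notin> pos_roots R I"
      using reflection_simple_pos[OF I \<alpha>, of "reflection \<alpha> \<gamma>"] \<gamma>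
      by (auto simp: reflection_reflection)
    with pos show ?thesis by blast
  qed
  then show ?thesis
    using refl_group_closed[OF v, of "{g. \<forall>\<beta>\<in>pos_roots R \<Delta> - pos_roots R I.
      g \<beta> \<in> pos_roots R \<Delta> - pos_roots R I}"] \<beta> by auto
qed

lemma ext_P_bruhat_le_right_mult:
  assumes I: "I \<subseteq> \<Delta>" and v: "v \<in> refl_group I" and le: "ext_P_bruhat_le R \<Delta> I x y"
  shows "ext_P_bruhat_le R \<Delta> I (x \<circ> v) (y \<circ> v)"
  using le unfolding ext_P_bruhat_le_def
proof (induction rule: rtranclp_induct)
  case (step y z)
  let ?A = "pos_roots R \<Delta> - pos_roots R I"
  have A: "?A \<subseteq> pos_roots R \<Delta>" by blast
  from step.hyps(2) obtain \<alpha> where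
    \<alpha>: "y \<in> refl_group R" "\<alpha> \<in> ?A" "z = y \<circ> reflection \<alpha>" "y \<alpha> \<in> pos_roots R \<Delta>"
    by (auto simp: refl_step_iff[OF A])
  from v obtain v' where v': "v' \<in> refl_group I" "v \<circ> v' = id"
    by (rule refl_group_inverse)
  then have vv': "v (v' \<alpha>) = \<alpha>"
    by (simp add: fun_eq_iff)
  then have "z \<circ> v = (y \<circ> v) \<circ> reflection (v' \<alpha>)"
    using reflection_conj[OF orthogonal_refl_group[OF v], of "v' \<alpha>"] \<alpha>(3) by (simp add: comp_assoc)
  moreover have "v' \<alpha> \<in> ?A"
    using complement_parabolic_closed[OF I v'(1) \<alpha>(2)] .
  moreover have "y \<circ> v \<in> refl_group R"
    using refl_group_comp \<alpha>(1) refl_group_parabolic[OF I v] by blast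
  \<comment> \<open>The deciding root is unchanged:
    \<open>(y \<circ> v) (v' \<alpha>) = y \<alpha>\<close>.\<close>
  ultimately have "refl_step R \<Delta> ?A (y \<circ> v) (z \<circ> v)"
    using \<alpha>(4) vv' unfolding refl_step_iff[OF A] by auto
  from rtranclp.rtrancl_into_rtrancl[of "refl_step R \<Delta> ?A", OF step.IH this]
  show ?case .
qed (rule rtranclp.rtrancl_refl)

section \<open>Minimal coset representatives and the comparison of the two orders\<close>

lemma chain_weyl_length:
  "(refl_step R \<Delta> A)\<^sup>*\<^sup>* x y \<Longrightarrow> x = y \<or> weyl_length \<Delta> x < weyl_length \<Delta> y"
  by (induction rule: rtranclp_induct) (auto simp: refl_step_def)

text \<open>Write \<open>y\<close> for \<open>reflection a \<circ> w\<close>. Minimality passes to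
  \<open>y\<close> because the length of \<open>w\<close> is at most that of
  \<open>w \<circ> v\<close>, hence at most one more than that of \<open>y \<circ> v\<close>, while
  \<open>y\<close> is strictly shorter than \<open>w\<close>. The step from \<open>y\<close> to
  \<open>w\<close> cannot be labelled by a root of the parabolic, since then \<open>y\<close> would
  be a shorter element of the coset of \<open>w\<close>.\<close>

lemma min_coset_rep_left_descent:
  assumes I: "I \<subseteq> \<Delta>" and w: "w \<in> min_coset_reps R \<Delta> I" and a: "a \<in> \<Delta>"
    and less: "weyl_length \<Delta> (reflection a \<circ> w) < weyl_length \<Delta> w"
  shows "reflection a \<circ> w \<in> min_coset_reps R \<Delta> I"
    and "refl_step R \<Delta> (pos_roots R \<Delta> - pos_roots R I) (reflection a \<circ> w) w"
proof -
  have wW: "w \<in> refl_group R" and min: "\<And>v. v \<in> refl_group I \<Longrightarrow> weyl_length \<Delta> w \<le> weyl_length \<Delta> (w \<circ> v)"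
    using w by (auto simp: min_coset_reps_def)
  let ?y = "reflection a \<circ> w"
  have aw: "reflection a \<circ> ?y = w"
    by (simp add: fun_eq_iff reflection_reflection)
  have yW: "?y \<in> refl_group R"
    using wW a simple_in_R by (auto intro!: refl_group_comp refl_group_reflection)
  show "?y \<in> min_coset_reps R \<Delta> I"
    unfolding min_coset_reps_def
  proof (intro CollectI conjI ballI yW)
    fix v assume v: "v \<in> refl_group I"
    have "weyl_length \<Delta> (reflection a \<circ> (?y \<circ> v)) \<le> Suc (weyl_length \<Delta> (?y \<circ> v))"
      using weyl_length_reflection_le a yW refl_group_comp refl_group_parabolic[OF I v] by blast
    moreover have "reflection a \<circ> (?y \<circ> v) = w \<circ> v"
      using aw by (simp add: fun_eq_iff)
    ultimately show "weyl_length \<Delta> ?y \<le> weyl_length \<Delta> (?y \<circ> v)"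
      using min[OF v] less by simp
  qed
  obtain w' where w': "w' \<in> refl_group R" "w \<circ> w' = id"
    using wW by (rule refl_group_inverse)
  \<comment> \<open>The positive one of the two roots \<open>w' a\<close> and \<open>- w' a\<close>,
    where \<open>w'\<close> inverts \<open>w\<close>; both define the same reflection, and it turns
    left multiplication by \<open>reflection a\<close> into right multiplication.\<close>
  define \<gamma> where "\<gamma> = (if w' a \<in> pos_roots R \<Delta> then w' a else - w' a)"
  have "w' a \<in> R"
    using refl_group_root w'(1) a simple_in_R by blast
  then have pos: "\<gamma> \<in> pos_roots R \<Delta>"
    using pos_or_neg by (auto simp: \<gamma>_def)
  have "reflection \<gamma> = reflection (w' a)"
    by (simp add: \<gamma>_def reflection_uminus)
  then have y: "?y = w \<circ> reflection \<gamma>"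
    using reflection_conj[OF orthogonal_refl_group[OF wW], of "w' a"] w'(2) by (simp add: fun_eq_iff)
  have "\<gamma> \<notin> pos_roots R I"
    using reflection_pos_root_in_refl_group[OF I] min less y by (metis not_le)
  moreover have "w = ?y \<circ> reflection \<gamma>"
    unfolding y by (simp add: comp_assoc reflection_invol)
  ultimately show "refl_step R \<Delta> (pos_roots R \<Delta> - pos_roots R I) ?y w"
    using pos yW less unfolding refl_step_def by blast
qed

lemma bruhat_le_min_coset_rep:
  assumes I: "I \<subseteq> \<Delta>" and "w \<in> min_coset_reps R \<Delta> I" and "bruhat_le R \<Delta> u w"
  shows "ext_P_bruhat_le R \<Delta> I u w"
  using assms(2,3)
proof (induction "weyl_length \<Delta> w" arbitrary: u w rule: less_induct)
  case less
  let ?A = "pos_roots R \<Delta> - pos_roots R I"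
  have A: "?A \<subseteq> pos_roots R \<Delta>" by blast
  have "w \<in> refl_group R"
    using less.prems by (simp add: min_coset_reps_def)
  then obtain as where as: "as \<in> lists \<Delta>" "refl_word as = w" "length as = weyl_length \<Delta> w"
    by (rule reduced_word)
  show ?case
  proof (cases as)
    case Nil
    \<comment> \<open>Here \<open>w\<close> has length 0, and a nontrivial chain would start at a
      still smaller length.\<close>
    then have "u = w"
      using chain_weyl_length less.prems(2) as by (force simp: bruhat_le_def)
    then show ?thesis
      by (simp add: ext_P_bruhat_le_def)
  next
    case (Cons a bs)
    let ?y = "reflection a \<circ> w"
    \<comment> \<open>The first letter of a reduced word is a left descent: removing it leaves a
      shorter word for \<open>?y\<close>.\<close>
    have a: "a \<in> \<Delta>"
      using as Cons by auto
    have "?y = refl_word bs"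
      unfolding as(2)[symmetric] Cons by (simp add: fun_eq_iff reflection_reflection)
    then have desc: "weyl_length \<Delta> ?y < weyl_length \<Delta> w"
      using weyl_length_le[of bs] as Cons by simp
    note y = min_coset_rep_left_descent[OF I less.prems(1) a desc]
    have aw: "reflection a \<circ> ?y = w" and au: "reflection a \<circ> (reflection a \<circ> u) = u"
      by (simp_all add: fun_eq_iff reflection_reflection)
    from chain_left_cases[OF order_refl a less.prems(2)[unfolded bruhat_le_def]]
    show ?thesis
    proof
      assume "(refl_step R \<Delta> (pos_roots R \<Delta>))\<^sup>*\<^sup>* (reflection a \<circ> u) ?y"
      then have "(refl_step R \<Delta> ?A)\<^sup>*\<^sup>* (reflection a \<circ> u) ?y"
        using less.hyps[OF desc y(1)] by (simp add: bruhat_le_def ext_P_bruhat_le_def)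
      \<comment> \<open>Multiplying by \<open>reflection a\<close> again returns to \<open>u\<close>
        and \<open>w\<close>; the required upward step at the end is the one from \<open>?y\<close>
        to \<open>w\<close>.\<close>
      from chain_left_mult[OF A a this] y(2) show ?thesis
        by (simp only: aw au ext_P_bruhat_le_def)
    next
      assume "(refl_step R \<Delta> (pos_roots R \<Delta>))\<^sup>*\<^sup>* u ?y"
      then have "(refl_step R \<Delta> ?A)\<^sup>*\<^sup>* u ?y"
        using less.hyps[OF desc y(1)] by (simp add: bruhat_le_def ext_P_bruhat_le_def)
      with y(2) show ?thesis
        by (simp add: ext_P_bruhat_le_def)
    qed
  qed
qed

lemma ext_P_bruhat_le_imp_bruhat_le:
  "ext_P_bruhat_le R \<Delta> I x y \<Longrightarrow> bruhat_le R \<Delta> x y"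
  unfolding ext_P_bruhat_le_def bruhat_le_def
  by (erule rtranclp_mono[THEN predicate2D, rotated]) (auto simp: refl_step_def)

lemma ex_min_coset_rep:
  assumes I: "I \<subseteq> \<Delta>" and w: "w \<in> refl_group R"
  obtains v where "v \<in> refl_group I" "w \<circ> v \<in> min_coset_reps R \<Delta> I"
proof -
  obtain v where v: "v \<in> refl_group I"
    and min: "\<And>v'. v' \<in> refl_group I \<Longrightarrow> weyl_length \<Delta> (w \<circ> v) \<le> weyl_length \<Delta> (w \<circ> v')"
    using ex_has_least_nat[of "\<lambda>v. v \<in> refl_group I" id "\<lambda>v. weyl_length \<Delta> (w \<circ> v)"] refl_group_id
    by blast
  have "w \<circ> v \<in> min_coset_reps R \<Delta> I"
    using w v min refl_group_comp refl_group_parabolic[OF I v]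
    by (auto simp: min_coset_reps_def comp_assoc)
  with v that show ?thesis by blast
qed

end

theorem theorem3p6:
  fixes R \<Delta> I :: "'a::euclidean_space set" and u w :: "'a \<Rightarrow> 'a"
  assumes "irreducible_root_system R"
    and "simple_roots R \<Delta>"
    and "I \<subseteq> \<Delta>"
    and "u \<in> refl_group R"
    and "w \<in> refl_group R"
  shows "(ext_P_bruhat_le R \<Delta> I u w \<longleftrightarrow>
            (\<forall>v \<in> refl_group I. ext_P_bruhat_le R \<Delta> I (u \<circ> v) (w \<circ> v)))
       \<and> ((\<forall>v \<in> refl_group I. ext_P_bruhat_le R \<Delta> I (u \<circ> v) (w \<circ> v)) \<longleftrightarrow>
            (\<exists>v \<in> refl_group I. w \<circ> v \<in> min_coset_reps R \<Delta> I \<and> bruhat_le R \<Delta> (u \<circ> v) (w \<circ> v)))"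
proof -
  interpret root_basis R \<Delta>
    using assms by unfold_locales (auto simp: irreducible_root_system_def)
  have 12: "\<forall>v \<in> refl_group I. ext_P_bruhat_le R \<Delta> I (u \<circ> v) (w \<circ> v)" if "ext_P_bruhat_le R \<Delta> I u w"
    using ext_P_bruhat_le_right_mult[OF assms(3) _ that] by blast
  have 23: "\<exists>v \<in> refl_group I. w \<circ> v \<in> min_coset_reps R \<Delta> I \<and> bruhat_le R \<Delta> (u \<circ> v) (w \<circ> v)"
    if "\<forall>v \<in> refl_group I. ext_P_bruhat_le R \<Delta> I (u \<circ> v) (w \<circ> v)"
    \<comment> \<open>The witness depends on \<open>w\<close> alone: it makes
      \<open>w \<circ> v\<close> minimal in its coset, and the hypothesis is then read at this
      \<open>v\<close>.\<close>
    using ex_min_coset_rep[OF assms(3,5)] that ext_P_bruhat_le_imp_bruhat_le by metis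
  have 31: "ext_P_bruhat_le R \<Delta> I u w"
    if "\<exists>v \<in> refl_group I. w \<circ> v \<in> min_coset_reps R \<Delta> I \<and> bruhat_le R \<Delta> (u \<circ> v) (w \<circ> v)"
  proof -
    from that obtain v where v: "v \<in> refl_group I"
      and le: "ext_P_bruhat_le R \<Delta> I (u \<circ> v) (w \<circ> v)"
      using bruhat_le_min_coset_rep[OF assms(3)] by blast
    from v obtain v' where v': "v' \<in> refl_group I" "v \<circ> v' = id"
      by (rule refl_group_inverse)
    \<comment> \<open>The comparison is carried back by the inverse of \<open>v\<close>, which again
      lies in \<open>refl_group I\<close>.\<close>
    from ext_P_bruhat_le_right_mult[OF assms(3) v'(1) le] show ?thesis
      by (simp add: comp_assoc v'(2))
  qed
  from 12 23 31 show ?thesis by blast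
qed

end
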